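(* Let $n\geq 3$ be an integer and let $G$ be a connected graph of order $n$. (1) If ($n \geq 7$ or $n=3$ or $n=5$), $\rho(G)\geq \rho(K_1 \vee (K_{n-2}+K_1))$ and $G \neq K_1 \vee (K_{n-2}+K_1)$, then $G-v$ has a $\{K_2,\{C_t : t\geq 3\}\}$-factor for every $v\in V(G)$. (2) If $n\in\{4,6\}$, $\rho(G)\geq \rho(K_{\frac{n}{2}} \vee \frac{n}{2}K_1)$ and $G \neq K_{\frac{n}{2}} \vee \frac{n}{2}K_1$, then $G-v$ has a $\{K_2,\{C_t : t\geq 3\}\}$-factor for every $v\in V(G)$.
   Context: All graphs are finite, simple and undirected. The order of $G$ is its number of vertices; $G-v$ is $G$ with the vertex $v$ and its incident edges deleted. $\rho(G)$ is the largest eigenvalue of the adjacency matrix of $G$. $K_m$ is the complete graph on $m$ vertices, $C_t$ the cycle on $t$ vertices, $G_1+G_2$ is the (vertex-disjoint) union, $mK_1$ is the graph consisting of $m$ isolated vertices, and the join $G_1\vee G_2$ is obtained from vertex-disjoint $G_1,G_2$ by adding all edges between $V(G_1)$ and $V(G_2)$. Equality of graphs means isomorphism. A $\{K_2,\{C_t : t\geq 3\}\}$-factor of a graph $H$ is a spanning subgraph of $H$ each of whose connected components is isomorphic to $K_2$ or to a cycle $C_t$ with $t\geq 3$. *)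

theory Defs
  imports
    "Graph_Theory.Digraph_Isomorphism"
    "Jordan_Normal_Form.Char_Poly"
begin

text \<open>
  A finite simple undirected graph is a \<open>pair_graph\<close>: finite, loop-free and symmetric, so that an
  edge \<open>uv\<close> is stored as the two arcs \<open>(u, v)\<close> and \<open>(v, u)\<close>. Equality of graphs is \<open>digraph_iso\<close>.
\<close>

definition complete_graph :: "nat \<Rightarrow> nat pair_pre_digraph" where
  "complete_graph m = \<lparr> pverts = {..<m}, parcs = {(u, v). u < m \<and> v < m \<and> u \<noteq> v} \<rparr>"

definition empty_graph :: "nat \<Rightarrow> nat pair_pre_digraph" where
  "empty_graph m = \<lparr> pverts = {..<m}, parcs = {} \<rparr>"

text \<open>Only meaningful for \<open>t \<ge> 3\<close>.\<close>

definition cycle_graph :: "nat \<Rightarrow> nat pair_pre_digraph" where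
  "cycle_graph t =
    \<lparr> pverts = {..<t},
      parcs = {(u, v). u < t \<and> v < t \<and> (v = Suc u mod t \<or> u = Suc v mod t)} \<rparr>"

definition graph_union ::
  "'a pair_pre_digraph \<Rightarrow> 'b pair_pre_digraph \<Rightarrow> ('a + 'b) pair_pre_digraph" where
  "graph_union G H =
    \<lparr> pverts = pverts G <+> pverts H,
      parcs = map_prod Inl Inl ` parcs G \<union> map_prod Inr Inr ` parcs H \<rparr>"

definition graph_join ::
  "'a pair_pre_digraph \<Rightarrow> 'b pair_pre_digraph \<Rightarrow> ('a + 'b) pair_pre_digraph" where
  "graph_join G H =
    \<lparr> pverts = pverts G <+> pverts H,
      parcs = parcs (graph_union G H)
        \<union> (Inl ` pverts G) \<times> (Inr ` pverts H)
        \<union> (Inr ` pverts H) \<times> (Inl ` pverts G) \<rparr>"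

text \<open>The adjacency matrix with rows and columns ordered by the list \<open>vs\<close> of vertices.\<close>

definition adjacency_mat :: "'a pair_pre_digraph \<Rightarrow> 'a list \<Rightarrow> real mat" where
  "adjacency_mat G vs =
    mat (length vs) (length vs) (\<lambda>(i, j). if (vs ! i, vs ! j) \<in> parcs G then 1 else 0)"

text \<open>
  The eigenvalues do not depend on the enumeration \<open>vs\<close> of the vertices
  (see \<open>adjacency_eigenvalues_eq\<close> below), and, the matrix being symmetric, they are all real.
\<close>

definition adjacency_eigenvalues :: "'a pair_pre_digraph \<Rightarrow> real set" where
  "adjacency_eigenvalues G =
    {k. \<exists>vs. distinct vs \<and> set vs = pverts G \<and> eigenvalue (adjacency_mat G vs) k}"

definition graph_spectral_radius :: "'a pair_pre_digraph \<Rightarrow> real" where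
  "graph_spectral_radius G = Max (adjacency_eigenvalues G)"

text \<open>
  The subgraph \<open>F\<close> is required to be a graph itself, i.e. it contains both or neither of the two
  arcs of an edge; its strongly connected components are then its connected components.
\<close>

definition has_K2_cycle_factor :: "('a, 'b) pre_digraph \<Rightarrow> bool" where
  "has_K2_cycle_factor H \<longleftrightarrow>
    (\<exists>F. graph F \<and> spanning F H \<and>
      (\<forall>C \<in> pre_digraph.sccs F.
        digraph_iso C (with_proj (complete_graph 2)) \<or>
        (\<exists>t\<ge>3. digraph_iso C (with_proj (cycle_graph t)))))"

lemma pair_graph_complete_graph: "pair_graph (complete_graph m)"
proof -
  have "finite ({..<m} \<times> {..<m})" by simp
  then have "finite (parcs (complete_graph m))"
    by (rule rev_finite_subset) (auto simp: complete_graph_def)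
  then show ?thesis
    by unfold_locales (auto simp: complete_graph_def symmetric_def intro: symI)
qed

lemma pair_graph_empty_graph: "pair_graph (empty_graph m)"
  by unfold_locales (auto simp: empty_graph_def symmetric_def intro: symI)

lemma pair_graph_cycle_graph:
  assumes "t \<ge> 3"
  shows "pair_graph (cycle_graph t)"
proof -
  have ne: "Suc u mod t \<noteq> u" if "u < t" for u
    using that assms by (cases "Suc u = t") auto
  have "finite ({..<t} \<times> {..<t})" by simp
  then have "finite (parcs (cycle_graph t))"
    by (rule rev_finite_subset) (auto simp: cycle_graph_def)
  then show ?thesis
    by unfold_locales (auto simp: cycle_graph_def symmetric_def ne ne[symmetric] intro: symI)
qed

lemma pair_graph_graph_union:
  assumes "pair_graph G" "pair_graph H"
  shows "pair_graph (graph_union G H)"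
proof -
  interpret G: pair_graph G by fact
  interpret H: pair_graph H by fact
  show ?thesis
    by unfold_locales
      (auto simp: graph_union_def symmetric_def
        dest: G.in_arcsD1 G.in_arcsD2 H.in_arcsD1 H.in_arcsD2 G.no_loops' H.no_loops'
        intro!: symI intro: G.arcs_symmetric H.arcs_symmetric rev_image_eqI)
qed

lemma pair_graph_graph_join:
  assumes "pair_graph G" "pair_graph H"
  shows "pair_graph (graph_join G H)"
proof -
  interpret G: pair_graph G by fact
  interpret H: pair_graph H by fact
  interpret U: pair_graph "graph_union G H" using assms by (rule pair_graph_graph_union)
  have V: "pverts (graph_union G H) = pverts G <+> pverts H"
    by (simp add: graph_union_def)
  show ?thesis
    by unfold_locales
      (auto simp: graph_join_def symmetric_def V
        dest: U.in_arcsD1[unfolded V] U.in_arcsD2[unfolded V] U.no_loops'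
        intro!: symI intro: U.arcs_symmetric)
qed

lemma eigenvalue_adjacency_mat_iff:
  assumes "distinct vs" "set vs = pverts G"
  shows "eigenvalue (adjacency_mat G vs) k \<longleftrightarrow>
    (\<exists>x. (\<exists>v\<in>pverts G. x v \<noteq> 0) \<and>
      (\<forall>v\<in>pverts G. (\<Sum>w\<in>pverts G. if (v, w) \<in> parcs G then x w else 0) = k * x v))"
    (is "?L \<longleftrightarrow> ?R")
proof -
  let ?n = "length vs" and ?A = "adjacency_mat G vs"
  have bij: "bij_betw ((!) vs) {0..<?n} (pverts G)"
    using assms bij_betw_nth[of vs "{0..<?n}" "set vs"] by (simp add: atLeast0LessThan)
  have row: "(?A *\<^sub>v vec ?n (\<lambda>i. x (vs ! i))) $ i
      = (\<Sum>w\<in>pverts G. if (vs ! i, w) \<in> parcs G then x w else 0)" if "i < ?n" for i x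
  proof -
    have "(?A *\<^sub>v vec ?n (\<lambda>i. x (vs ! i))) $ i
        = (\<Sum>j = 0..<?n. if (vs ! i, vs ! j) \<in> parcs G then x (vs ! j) else 0)"
      using that by (auto simp: adjacency_mat_def scalar_prod_def intro!: sum.cong)
    also have "\<dots> = (\<Sum>w\<in>pverts G. if (vs ! i, w) \<in> parcs G then x w else 0)"
      by (rule sum.reindex_bij_betw[OF bij])
    finally show ?thesis .
  qed
  have all: "(\<forall>v\<in>pverts G. P v) \<longleftrightarrow> (\<forall>i<?n. P (vs ! i))" for P
    using assms(2) by (metis in_set_conv_nth nth_mem)
  have ev: "eigenvector ?A (vec ?n (\<lambda>i. x (vs ! i))) k \<longleftrightarrow>
      (\<exists>v\<in>pverts G. x v \<noteq> 0) \<and>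
      (\<forall>v\<in>pverts G. (\<Sum>w\<in>pverts G. if (v, w) \<in> parcs G then x w else 0) = k * x v)" for x
  proof -
    have dim: "dim_row ?A = ?n" by (simp add: adjacency_mat_def)
    have "vec ?n (\<lambda>i. x (vs ! i)) \<noteq> 0\<^sub>v ?n \<longleftrightarrow> \<not> (\<forall>v\<in>pverts G. x v = 0)"
      unfolding all by (auto simp: vec_eq_iff)
    moreover have "?A *\<^sub>v vec ?n (\<lambda>i. x (vs ! i)) = k \<cdot>\<^sub>v vec ?n (\<lambda>i. x (vs ! i)) \<longleftrightarrow>
        (\<forall>v\<in>pverts G. (\<Sum>w\<in>pverts G. if (v, w) \<in> parcs G then x w else 0) = k * x v)"
      unfolding all by (subst vec_eq_iff) (simp add: dim row del: index_mult_mat_vec)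
    ultimately show ?thesis unfolding eigenvector_def dim by auto
  qed
  show ?thesis
  proof
    assume ?L
    then obtain y where y: "eigenvector ?A y k" unfolding eigenvalue_def by blast
    then have dy: "dim_vec y = ?n" by (auto simp: eigenvector_def adjacency_mat_def)
    define x where "x v = y $ the_inv_into {0..<?n} ((!) vs) v" for v
    have "vec ?n (\<lambda>i. x (vs ! i)) = y"
      using dy bij by (intro eq_vecI) (auto simp: x_def bij_betw_def the_inv_into_f_f)
    then show ?R using y ev[of x] by auto
  next
    assume ?R
    then show ?L using ev unfolding eigenvalue_def by blast
  qed
qed

lemma adjacency_eigenvalues_eq:
  assumes "distinct vs" "set vs = pverts G"
  shows "adjacency_eigenvalues G = {k. eigenvalue (adjacency_mat G vs) k}"
proof -
  have "eigenvalue (adjacency_mat G ws) k = eigenvalue (adjacency_mat G vs) k"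
    if "distinct ws" "set ws = pverts G" for ws k
    by (simp only: eigenvalue_adjacency_mat_iff[OF that] eigenvalue_adjacency_mat_iff[OF assms])
  then show ?thesis using assms unfolding adjacency_eigenvalues_def by blast
qed

end

theory Submission
  imports Defs "HOL-Combinatorics.Orbits" "Jordan_Normal_Form.Spectral_Radius"
begin

text \<open>
  If \<open>G - v\<close> has no factor, then Hall's theorem provides an independent set with too few neighbours
  (an injective choice of neighbours would be a permutation whose cycles form a factor). Hence \<open>G\<close>
  is a spanning subgraph of \<open>K\<^sub>s \<or> (K\<^sub>r + sK\<^sub>1)\<close> with \<open>s \<ge> 1\<close> and \<open>n = 2s + r\<close>.
  A positive vector that is constant on the three parts and satisfies \<open>A x \<le> \<lambda> x\<close> bounds all
  eigenvalues of \<open>G\<close> by \<open>\<lambda>\<close>. For the extremal \<open>s\<close> one takes the positive eigenvector of the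
  extremal graph, and for connected \<open>G\<close> equality forces all edges to be present; for the other
  values of \<open>s\<close> an explicit vector gives a bound below the extremal spectral radius.
\<close>

section \<open>Cycle factors from permutations\<close>

text \<open>Induction on \<open>card X\<close>. If some nonempty proper subset \<open>S\<close> is
  tight, having exactly \<open>card S\<close> neighbours, then \<open>S\<close> and
  \<open>X - S\<close> are matched separately. Otherwise every nonempty proper subset has a surplus
  neighbour, so one pair can be matched arbitrarily and removed.\<close>

lemma hall_injection:
  assumes "finite X" and "\<And>x. x \<in> X \<Longrightarrow> finite (N x)"
    and "\<And>S. S \<subseteq> X \<Longrightarrow> card S \<le> card (\<Union>x\<in>S. N x)"
  obtains f where "inj_on f X" and "\<And>x. x \<in> X \<Longrightarrow> f x \<in> N x"
proof -
  have "\<exists>f. inj_on f X \<and> (\<forall>x\<in>X. f x \<in> N x)"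
    using assms
  proof (induction "card X" arbitrary: X N rule: less_induct)
    case less
    note fin = less.prems(1) and finN = less.prems(2) and hall = less.prems(3)
    show ?case
    proof (cases "X = {}")
      case True
      then show ?thesis by simp
    next
      case False
      then obtain a where a: "a \<in> X" by blast
      show ?thesis
      proof (cases "\<exists>S. S \<subset> X \<and> S \<noteq> {} \<and> card (\<Union>x\<in>S. N x) = card S")
        case True
        then obtain S where S: "S \<subset> X" "S \<noteq> {}" "card (\<Union>x\<in>S. N x) = card S" by blast
        define U where "U = (\<Union>x\<in>S. N x)"
        have finS: "finite S" using S(1) fin by (meson finite_subset psubset_imp_subset)
        have "card S < card X" using S fin by (simp add: psubset_card_mono)
        moreover have "card S' \<le> card (\<Union>x\<in>S'. N x)" if "S' \<subseteq> S" for S'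
          using that S by (intro hall) auto
        ultimately obtain f where f: "inj_on f S" "\<forall>x\<in>S. f x \<in> N x"
          using less.hyps[of S N] S finS finN by blast
        have "card (X - S) < card X"
          using S fin finS by (intro psubset_card_mono) auto
        \<comment> \<open>Hall's condition for \<open>Z \<union> S\<close> passes to
          \<open>Z\<close> with \<open>U\<close> removed from the neighbourhoods, because
          \<open>S\<close> and \<open>U\<close> have equal size and cancel.\<close>
        moreover have "card Z \<le> card (\<Union>x\<in>Z. N x - U)" if Z: "Z \<subseteq> X - S" for Z
        proof -
          have finZ: "finite Z" using Z fin finite_subset by blast
          have "card Z + card S = card (Z \<union> S)"
            using Z finZ finS by (subst card_Un_disjoint) auto
          also have "\<dots> \<le> card (\<Union>x\<in>Z \<union> S. N x)"
            using Z S by (intro hall) auto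
          also have "(\<Union>x\<in>Z \<union> S. N x) = (\<Union>x\<in>Z. N x - U) \<union> U"
            by (auto simp: U_def)
          also have "card \<dots> \<le> card (\<Union>x\<in>Z. N x - U) + card U"
            by (rule card_Un_le)
          finally show ?thesis using S(3) by (simp add: U_def)
        qed
        ultimately obtain g where g: "inj_on g (X - S)" "\<forall>x\<in>X - S. g x \<in> N x - U"
          using less.hyps[of "X - S" "\<lambda>x. N x - U"] fin finN by auto
        define h where "h x = (if x \<in> S then f x else g x)" for x
        have fU: "f x \<in> U" if "x \<in> S" for x using f that by (auto simp: U_def)
        have "inj_on h X"
        proof (rule inj_onI)
          fix x y assume xy: "x \<in> X" "y \<in> X" "h x = h y"
          have gU: "g x \<notin> U" if "x \<in> X - S" for x using g(2) that by blast
          show "x = y"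
          proof (cases "x \<in> S"; cases "y \<in> S")
            assume "x \<in> S" "y \<in> S"
            then show ?thesis using xy f(1) by (simp add: h_def inj_on_eq_iff)
          next
            assume "x \<in> S" "y \<notin> S"
            then show ?thesis using xy fU[of x] gU[of y] by (simp add: h_def)
          next
            assume "x \<notin> S" "y \<in> S"
            then show ?thesis using xy fU[of y] gU[of x] by (simp add: h_def)
          next
            assume "x \<notin> S" "y \<notin> S"
            then show ?thesis using xy inj_onD[OF g(1), of x y] by (simp add: h_def)
          qed
        qed
        moreover have "\<forall>x\<in>X. h x \<in> N x" using f g by (auto simp: h_def)
        ultimately show ?thesis by blast
      next
        case False
        have "card {a} \<le> card (\<Union>x\<in>{a}. N x)" using a by (intro hall) auto
        then have "N a \<noteq> {}" by auto
        then obtain b where b: "b \<in> N a" by blast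
        \<comment> \<open>The strict inequality for proper subsets compensates for the loss of the
          single element \<open>b\<close>.\<close>
        have "card Z \<le> card (\<Union>x\<in>Z. N x - {b})" if Z: "Z \<subseteq> X - {a}" for Z
        proof (cases "Z = {}")
          case False
          have "Z \<subset> X" using Z a by blast
          then have "card Z < card (\<Union>x\<in>Z. N x)"
            using \<open>\<not> (\<exists>S. _ S)\<close> False hall[of Z] by (metis le_neq_implies_less psubset_imp_subset)
          also have "(\<Union>x\<in>Z. N x) \<subseteq> insert b (\<Union>x\<in>Z. N x - {b})" by auto
          then have "card (\<Union>x\<in>Z. N x) \<le> card (insert b (\<Union>x\<in>Z. N x - {b}))"
            using Z fin finN by (intro card_mono) (auto intro!: finite_UN_I intro: finite_subset)
          also have "\<dots> \<le> Suc (card (\<Union>x\<in>Z. N x - {b}))" by (rule card_insert_le_m1) auto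
          finally show ?thesis by simp
        qed simp
        moreover have "card (X - {a}) < card X" by (rule card_Diff1_less[OF fin a])
        ultimately obtain g where g: "inj_on g (X - {a})" "\<forall>x\<in>X - {a}. g x \<in> N x - {b}"
          using less.hyps[of "X - {a}" "\<lambda>x. N x - {b}"] fin finN by auto
        have "inj_on (g(a := b)) X"
          using g by (auto simp: inj_on_def)
        moreover have "\<forall>x\<in>X. (g(a := b)) x \<in> N x" using g b by auto
        ultimately show ?thesis by blast
      qed
    qed
  qed
  then show ?thesis using that by blast
qed

section \<open>Permutation graphs and their components\<close>

text \<open>An arc of a pair digraph is the pair of its ends, so the vertex bijection
  \<open>f\<close> already determines the arc map \<open>map_prod f f\<close>.\<close>

lemma digraph_iso_with_projI:
  assumes "pair_wf_digraph G" and "pair_wf_digraph H" and "bij_betw f (pverts G) (pverts H)"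
    and "\<And>u v. u \<in> pverts G \<Longrightarrow> v \<in> pverts G \<Longrightarrow> (u, v) \<in> parcs G \<longleftrightarrow> (f u, f v) \<in> parcs H"
  shows "digraph_iso (with_proj G) (with_proj H)"
proof -
  interpret G: pair_wf_digraph G by fact
  interpret H: pair_wf_digraph H by fact
  define h where "h = \<lparr> iso_verts = f, iso_arcs = map_prod f f, iso_head = snd, iso_tail = fst \<rparr>"
  have inj: "inj_on f (pverts G)" and im: "f ` pverts G = pverts H"
    using assms(3) by (auto simp: bij_betw_def)
  have "inj_on (map_prod f f) (pverts G \<times> pverts G)"
    using inj by (auto simp: inj_on_def)
  then have "inj_on (map_prod f f) (parcs G)"
    by (rule inj_on_subset) (auto dest: G.wellformed')
  then have iso: "G.digraph_isomorphism h"
    unfolding G.digraph_isomorphism_def using inj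
    by (simp add: h_def G.wf_digraph_axioms)
  have "parcs H = map_prod f f ` parcs G"
  proof (intro equalityI subsetI)
    fix e assume e: "e \<in> parcs H"
    then obtain u v where "u \<in> pverts G" "v \<in> pverts G" "e = (f u, f v)"
      using im by (metis H.arc_fst_in_verts H.arc_snd_in_verts imageE prod.collapse)
    then show "e \<in> map_prod f f ` parcs G" using e assms(4) by (auto intro!: image_eqI[of _ _ "(u, v)"])
  next
    fix e assume "e \<in> map_prod f f ` parcs G"
    then show "e \<in> parcs H" using assms(4) by (auto dest: G.wellformed')
  qed
  then have "with_proj H = app_iso h (with_proj G)"
    using im by (simp add: app_iso_def h_def with_proj_def)
  then show ?thesis using iso unfolding digraph_iso_def by blast
qed

text \<open>The functional digraph of \<open>p\<close> with directions forgotten. An orbit of length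
  2 yields a single edge, longer orbits yield cycles, and fixed points would yield loops.\<close>

definition permutation_graph :: "('a \<Rightarrow> 'a) \<Rightarrow> 'a set \<Rightarrow> 'a pair_pre_digraph" where
  "permutation_graph p V = \<lparr> pverts = V, parcs = {(u, v). u \<in> V \<and> v \<in> V \<and> (v = p u \<or> u = p v)} \<rparr>"

lemma pair_graph_permutation_graph:
  assumes "finite V" and "p permutes V" and "\<And>v. v \<in> V \<Longrightarrow> p v \<noteq> v"
  shows "pair_graph (permutation_graph p V)"
proof -
  have "finite (V \<times> V)" using assms by simp
  then have "finite (parcs (permutation_graph p V))"
    by (rule rev_finite_subset) (auto simp: permutation_graph_def)
  then show ?thesis
    using assms
    by unfold_locales (auto simp: permutation_graph_def symmetric_def intro!: symI, metis+)
qed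

text \<open>With \<open>t\<close> the first return time of \<open>u\<close>, the iterates
  \<open>f i\<close> for \<open>i < t\<close> list the orbit without repetition, and
  \<open>p\<close> acts on the indices as the successor modulo \<open>t\<close>. The absence of
  fixed points rules out \<open>t = 1\<close>.\<close>

lemma orbit_permutation_graph_iso:
  assumes "finite V" and "p permutes V" and "\<And>v. v \<in> V \<Longrightarrow> p v \<noteq> v" and "u \<in> V"
  defines "C \<equiv> permutation_graph p V \<restriction> orbit p u"
  shows "digraph_iso C (complete_graph 2) \<or> (\<exists>t\<ge>3. digraph_iso C (cycle_graph t))"
proof -
  interpret pair_graph "permutation_graph p V"
    using assms(1-3) by (rule pair_graph_permutation_graph)
  have perm: "permutation p" using assms(1,2) by (auto simp: permutation_permutes)
  have self: "u \<in> orbit p u" by (rule permutation_self_in_orbit[OF perm])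
  define t where "t = funpow_dist1 p u u"
  define f where "f i = (p ^^ i) u" for i
  have OV: "orbit p u \<subseteq> V" using permutes_orbit_subset[OF assms(2,4)] .
  have orb: "orbit p u = f ` {..<t}"
    using orbit_conv_funpow_dist1[OF self] by (simp add: f_def t_def atLeast0LessThan)
  have inj: "inj_on f {..<t}"
    using inj_on_funpow_dist1[OF self] by (simp add: f_def[abs_def] t_def atLeast0LessThan)
  have ft: "f t = u" unfolding f_def t_def by (rule funpow_dist1_prop[OF self])
  have t0: "t > 0" by (simp add: t_def)
  have pf: "p (f i) = f (Suc i mod t)" if "i < t" for i
  proof (cases "Suc i = t")
    case True
    then show ?thesis using ft by (simp add: f_def flip: True)
  next
    case False
    then show ?thesis using that by (simp add: f_def)
  qed
  have "t \<noteq> 1"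
  proof
    assume "t = 1"
    then show False using ft assms(3,4) by (simp add: f_def)
  qed
  then have t2: "t \<ge> 2" using t0 by simp
  \<comment> \<open>The same digraph as \<open>C\<close>, written as a pair digraph so that
    \<open>digraph_iso_with_projI\<close> applies.\<close>
  define D where "D = \<lparr> pverts = orbit p u, parcs = {(a, b). a \<in> orbit p u \<and> b \<in> orbit p u \<and> (b = p a \<or> a = p b)} \<rparr>"
  have C: "C = with_proj D"
    using OV by (auto simp: C_def D_def induce_subgraph_def with_proj_def permutation_graph_def)
  define E where "E = (if t = 2 then complete_graph 2 else cycle_graph t)"
  have bij: "bij_betw f {..<t} (orbit p u)" using inj orb by (simp add: bij_betw_def)
  have "digraph_iso (with_proj D) (with_proj E)"
  proof (rule digraph_iso_with_projI)
    show "pair_wf_digraph D" by unfold_locales (auto simp: D_def)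
    show "pair_wf_digraph E"
      by unfold_locales (auto simp: E_def complete_graph_def cycle_graph_def split: if_splits)
    have vE: "pverts E = {..<t}" by (auto simp: E_def complete_graph_def cycle_graph_def)
    show "bij_betw (the_inv_into {..<t} f) (pverts D) (pverts E)"
      using bij_betw_the_inv_into[OF bij] by (simp add: D_def vE)
    fix a b assume "a \<in> pverts D" "b \<in> pverts D"
    then obtain i j where ij: "a = f i" "b = f j" "i < t" "j < t"
      by (auto simp: D_def orb)
    have "(a, b) \<in> parcs D \<longleftrightarrow> f j = f (Suc i mod t) \<or> f i = f (Suc j mod t)"
      using ij pf by (auto simp: D_def orb)
    also have "\<dots> \<longleftrightarrow> j = Suc i mod t \<or> i = Suc j mod t"
      using ij t0 inj by (simp add: inj_on_eq_iff)
    also have "\<dots> \<longleftrightarrow> (i, j) \<in> parcs E"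
    proof (cases "t = 2")
      case True
      with ij have "i = 0 \<or> i = 1" "j = 0 \<or> j = 1" by auto
      with True show ?thesis by (auto simp: E_def complete_graph_def)
    next
      case False
      then show ?thesis using ij by (auto simp: E_def cycle_graph_def)
    qed
    finally show "(a, b) \<in> parcs D \<longleftrightarrow> (the_inv_into {..<t} f a, the_inv_into {..<t} f b) \<in> parcs E"
      using ij inj by (simp add: the_inv_into_f_f)
  qed
  then show ?thesis using t2 by (auto simp: C E_def split: if_splits)
qed

text \<open>The components of the permutation graph are the orbits of \<open>p\<close>: an edge
  leads to an image or a preimage under \<open>p\<close>, so a walk stays in one orbit; iterating
  \<open>p\<close> runs through all of that orbit, and symmetry supplies the way back.\<close>

lemma permutation_imp_K2_cycle_factor:
  assumes "pair_graph G" and "p permutes pverts G" and "\<And>v. v \<in> pverts G \<Longrightarrow> (v, p v) \<in> parcs G"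
  shows "has_K2_cycle_factor (with_proj G)"
proof -
  interpret G: pair_graph G by fact
  let ?V = "pverts G"
  define F where "F = permutation_graph p ?V"
  have nofix: "p v \<noteq> v" if "v \<in> ?V" for v
    using assms(3)[OF that] by (auto dest: G.no_loops')
  have finV: "finite ?V" by simp
  have "pair_graph F"
    unfolding F_def using finV assms(2) nofix by (rule pair_graph_permutation_graph)
  then interpret F: pair_graph F .
  have VF: "pverts F = ?V" by (simp add: F_def permutation_graph_def)
  have perm: "permutation p" using finV assms(2) permutation_permutes by blast
  have "spanning F G"
    unfolding spanning_def subgraph_def
    using assms(3) by (auto simp: VF F_def permutation_graph_def G.wf_digraph_axioms
        F.wf_digraph_axioms[unfolded F_def permutation_graph_def] intro: G.arcs_symmetric)
  moreover have "digraph_iso C (complete_graph 2) \<or> (\<exists>t\<ge>3. digraph_iso C (cycle_graph t))"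
    if C_scc: "C \<in> F.sccs" for C
  proof -
    obtain S where S: "S \<in> F.sccs_verts" and C: "C = with_proj F \<restriction> S"
      using C_scc F.sccs_conv_sccs_verts by auto
    obtain u where u: "u \<in> S" using S unfolding F.in_sccs_verts_conv_reachable by (metis ex_in_conv)
    have S_reach: "a \<rightarrow>\<^sup>*\<^bsub>with_proj F\<^esub> b" if "a \<in> S" "b \<in> S" for a b
      using S that unfolding F.in_sccs_verts_conv_reachable by meson
    have S_closed: "b \<in> S"
      if "a \<in> S" "a \<rightarrow>\<^sup>*\<^bsub>with_proj F\<^esub> b" "b \<rightarrow>\<^sup>*\<^bsub>with_proj F\<^esub> a" for a b
      using S that unfolding F.in_sccs_verts_conv_reachable by meson
    have "u \<rightarrow>\<^sup>*\<^bsub>with_proj F\<^esub> u" using u u by (rule S_reach)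
    then have uV: "u \<in> ?V" using F.reachable_in_verts(1) VF by metis
    have out: "v \<in> orbit p u" if "u \<rightarrow>\<^sup>*\<^bsub>with_proj F\<^esub> v" for v
      using that
    proof (induction rule: F.reachable_induct)
      case base
      show ?case by (rule permutation_self_in_orbit[OF perm])
    next
      case (step v w)
      then have "w = p v \<or> v = p w" by (auto simp: F_def permutation_graph_def)
      then show ?case
        using step.IH orbit.step permutation_self_in_orbit[OF perm]
        by (metis orbit_trans orbit_swap perm permutation_orbit_step)
    qed
    have into: "u \<rightarrow>\<^sup>*\<^bsub>with_proj F\<^esub> v" if "v \<in> orbit p u" for v
      using that
    proof induction
      case base
      have "(u, p u) \<in> parcs F" using uV assms(2) by (simp add: F_def permutation_graph_def permutes_in_image)
      then show ?case by auto
    next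
      case (step v)
      then have "v \<in> ?V" using F.reachable_in_verts(2) VF by metis
      then have "(v, p v) \<in> parcs F" using assms(2) by (simp add: F_def permutation_graph_def permutes_in_image)
      with step.IH show ?case using F.reachable_adj_trans by simp
    qed
    have "S = orbit p u"
    proof (intro equalityI subsetI)
      fix v assume "v \<in> S"
      then show "v \<in> orbit p u" using S_reach[OF u] out by simp
    next
      fix v assume "v \<in> orbit p u"
      then have "u \<rightarrow>\<^sup>*\<^bsub>with_proj F\<^esub> v" by (rule into)
      moreover from this have "v \<rightarrow>\<^sup>*\<^bsub>with_proj F\<^esub> u" using F.symmetric_reachable' by blast
      ultimately show "v \<in> S" using S_closed[OF u] by simp
    qed
    then show ?thesis
      using orbit_permutation_graph_iso[OF finV assms(2) nofix uV] by (simp add: C F_def)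
  qed
  ultimately show ?thesis
    unfolding has_K2_cycle_factor_def using F.graph_axioms by blast
qed

text \<open>The graph-theoretic half of Tutte's criterion: a violation of Hall's condition in the bipartite
  double cover is a set with few neighbours, and dropping from it all vertices that have a neighbour
  inside the set leaves an independent violating set.\<close>

lemma no_K2_cycle_factor_imp_independent:
  assumes "pair_graph G" and "\<not> has_K2_cycle_factor (with_proj G)"
  obtains I where "I \<subseteq> pverts G" and "\<And>u v. u \<in> I \<Longrightarrow> v \<in> I \<Longrightarrow> (u, v) \<notin> parcs G"
    and "card (parcs G `` I) < card I"
proof -
  interpret G: pair_graph G by fact
  let ?V = "pverts G"
  have N: "parcs G `` X \<subseteq> ?V" for X by (auto dest: G.wellformed')
  have finN: "finite (parcs G `` X)" for X using N finite_subset G.finite_verts by blast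
  have "\<exists>X\<subseteq>?V. card (parcs G `` X) < card X"
  proof (rule ccontr)
    assume "\<not> ?thesis"
    then have hall: "card X \<le> card (\<Union>x\<in>X. parcs G `` {x})" if "X \<subseteq> ?V" for X
      using that by (simp add: Image_eq_UN[of _ X, symmetric] not_less)
    obtain f where f: "inj_on f ?V" "\<And>x. x \<in> ?V \<Longrightarrow> f x \<in> parcs G `` {x}"
      by (rule hall_injection[of ?V "\<lambda>x. parcs G `` {x}"]) (use finN hall in auto)
    \<comment> \<open>\<open>permutes\<close> speaks of the whole type, hence the extension by the
      identity. On the finite set \<open>?V\<close> the injection \<open>f\<close> is also
      onto.\<close>
    define p where "p x = (if x \<in> ?V then f x else x)" for x
    have "f ` ?V \<subseteq> ?V" using f(2) N by blast
    then have "bij_betw p ?V ?V"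
      using f(1) endo_inj_surj[of ?V f] by (auto simp: bij_betw_def p_def inj_on_def)
    then have "p permutes ?V" by (rule bij_imp_permutes) (simp add: p_def)
    moreover have "(v, p v) \<in> parcs G" if "v \<in> ?V" for v
      using f(2)[OF that] that by (simp add: p_def)
    ultimately show False
      using permutation_imp_K2_cycle_factor[OF assms(1)] assms(2) by blast
  qed
  then obtain X where X: "X \<subseteq> ?V" "card (parcs G `` X) < card X" by blast
  have finX: "finite X" using X(1) finite_subset G.finite_verts by blast
  define I where "I = X - parcs G `` X"
  have "card X = card I + card (X \<inter> parcs G `` X)"
    unfolding I_def using finX by (simp add: card_Diff_subset_Int card_mono)
  moreover have "card (parcs G `` I) + card (X \<inter> parcs G `` X) \<le> card (parcs G `` X)"
  proof -
    \<comment> \<open>If a neighbour of some \<open>u\<close> in \<open>I\<close> lay in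
      \<open>X\<close>, then by symmetry \<open>u\<close> would be a neighbour of \<open>X\<close>,
      which the definition of \<open>I\<close> excludes. So the neighbours of \<open>I\<close> and
      the dropped vertices are disjoint parts of the neighbourhood of \<open>X\<close>, and the
      deficiency survives the dropping.\<close>
    have "parcs G `` I \<inter> X = {}" by (auto simp: I_def dest: G.arcs_symmetric)
    then have "card (parcs G `` I) + card (X \<inter> parcs G `` X) = card (parcs G `` I \<union> (X \<inter> parcs G `` X))"
      using finN finX by (intro card_Un_disjoint[symmetric]) auto
    also have "\<dots> \<le> card (parcs G `` X)" using finN by (intro card_mono) (auto simp: I_def)
    finally show ?thesis .
  qed
  ultimately have "card (parcs G `` I) < card I" using X(2) by linarith
  moreover have "I \<subseteq> ?V" using X(1) by (auto simp: I_def)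
  ultimately show ?thesis using that[of I] by (auto simp: I_def)
qed

section \<open>Eigenvalues of symmetric graphs\<close>

text \<open>Lets the estimates below work with functions on the vertices instead of enumerations and
  matrices.\<close>

lemma adjacency_eigenvalues_iff:
  assumes "pair_graph G"
  shows "k \<in> adjacency_eigenvalues G \<longleftrightarrow>
    (\<exists>x. (\<exists>v\<in>pverts G. x v \<noteq> 0) \<and>
      (\<forall>v\<in>pverts G. (\<Sum>w\<in>pverts G. if (v, w) \<in> parcs G then x w else 0) = k * x v))"
proof -
  interpret G: pair_graph G by fact
  obtain vs where vs: "set vs = pverts G" "distinct vs"
    using finite_distinct_list[OF G.pair_finite_verts] by blast
  then show ?thesis
    by (simp add: adjacency_eigenvalues_eq eigenvalue_adjacency_mat_iff)
qed

lemma finite_adjacency_eigenvalues: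
  assumes "pair_graph G"
  shows "finite (adjacency_eigenvalues G)"
proof -
  interpret G: pair_graph G by fact
  obtain vs where vs: "set vs = pverts G" "distinct vs"
    using finite_distinct_list[OF G.pair_finite_verts] by blast
  have "adjacency_mat G vs \<in> carrier_mat (length vs) (length vs)"
    by (simp add: adjacency_mat_def)
  then have "finite (spectrum (adjacency_mat G vs))" by (rule card_finite_spectrum)
  then show ?thesis using vs by (simp add: adjacency_eigenvalues_eq spectrum_def)
qed

text \<open>A complex eigenvector \<open>z\<close> for \<open>k\<close> always exists. Its Hermitian
  form \<open>q\<close> equals \<open>k\<close> times the squared norm \<open>r > 0\<close> and, by
  symmetry of \<open>A\<close>, its own conjugate; hence \<open>k\<close> is real.\<close>

lemma real_symmetric_mat_has_eigenvalue:
  fixes A :: "real mat"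
  assumes A: "A \<in> carrier_mat n n" and "n > 0"
    and sym: "\<And>i j. i < n \<Longrightarrow> j < n \<Longrightarrow> A $$ (i, j) = A $$ (j, i)"
  shows "\<exists>k. eigenvalue A k"
proof -
  define B where "B = map_mat complex_of_real A"
  have B: "B \<in> carrier_mat n n" using A by (simp add: B_def)
  obtain k where "eigenvalue B k"
    using spectrum_non_empty[OF B \<open>n > 0\<close>] by (auto simp: spectrum_def)
  then obtain z where "eigenvector B z k" unfolding eigenvalue_def by blast
  then have z: "z \<in> carrier_vec n" "z \<noteq> 0\<^sub>v n" "B *\<^sub>v z = k \<cdot>\<^sub>v z"
    using B by (auto simp: eigenvector_def)
  have row: "(\<Sum>j<n. complex_of_real (A $$ (i, j)) * z $ j) = k * z $ i" if "i < n" for i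
  proof -
    have "(B *\<^sub>v z) $ i = (\<Sum>j<n. complex_of_real (A $$ (i, j)) * z $ j)"
      using that A z(1) by (auto simp: B_def scalar_prod_def atLeast0LessThan intro!: sum.cong)
    then show ?thesis using z that by simp
  qed
  define r where "r = (\<Sum>i<n. (cmod (z $ i))\<^sup>2)"
  obtain i0 where i0: "i0 < n" "z $ i0 \<noteq> 0"
    using z(1,2) by (metis eq_vecI carrier_vecD index_zero_vec)
  have "r > 0" unfolding r_def
    by (rule sum_pos2[of _ i0]) (use i0 in auto)
  define q where "q = (\<Sum>i<n. \<Sum>j<n. complex_of_real (A $$ (i, j)) * z $ j * cnj (z $ i))"
  have "q = (\<Sum>i<n. k * z $ i * cnj (z $ i))"
    unfolding q_def by (intro sum.cong refl) (simp add: sum_distrib_right[symmetric] row)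
  also have "\<dots> = k * complex_of_real r"
    by (simp add: r_def sum_distrib_left mult.assoc complex_norm_square del: of_real_power)
  finally have q: "q = k * complex_of_real r" .
  have "cnj q = (\<Sum>i<n. \<Sum>j<n. complex_of_real (A $$ (i, j)) * cnj (z $ j) * z $ i)"
    by (simp add: q_def)
  also have "\<dots> = (\<Sum>j<n. \<Sum>i<n. complex_of_real (A $$ (i, j)) * cnj (z $ j) * z $ i)"
    by (rule sum.swap)
  also have "\<dots> = q"
    unfolding q_def by (intro sum.cong refl) (use sym in \<open>simp add: mult.commute mult.left_commute\<close>)
  finally have "cnj k = k" using q \<open>r > 0\<close> by simp
  then obtain \<kappa> where k: "k = complex_of_real \<kappa>"
    by (metis Reals_cnj_iff Reals_cases)
  \<comment> \<open>As \<open>A\<close> and \<open>k\<close> are real, the real and the imaginary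
    part of \<open>z\<close> each satisfy the eigenvalue equation, and one of them is nonzero at
    \<open>i0\<close>.\<close>
  have part: "A *\<^sub>v vec n (\<lambda>i. f (z $ i)) = \<kappa> \<cdot>\<^sub>v vec n (\<lambda>i. f (z $ i))"
    if f: "f = Re \<or> f = Im" for f
  proof (rule eq_vecI)
    fix i assume "i < dim_vec (\<kappa> \<cdot>\<^sub>v vec n (\<lambda>i. f (z $ i)))"
    then have i: "i < n" by simp
    have "(A *\<^sub>v vec n (\<lambda>i. f (z $ i))) $ i = (\<Sum>j<n. A $$ (i, j) * f (z $ j))"
      using i A by (auto simp: scalar_prod_def atLeast0LessThan intro!: sum.cong)
    also have "\<dots> = f (\<Sum>j<n. complex_of_real (A $$ (i, j)) * z $ j)"
      using f by auto
    also have "\<dots> = \<kappa> * f (z $ i)" using f by (auto simp: row[OF i] k)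
    finally show "(A *\<^sub>v vec n (\<lambda>i. f (z $ i))) $ i = (\<kappa> \<cdot>\<^sub>v vec n (\<lambda>i. f (z $ i))) $ i"
      using i by simp
  qed (use A in simp)
  obtain f where f: "f = Re \<or> f = Im" "f (z $ i0) \<noteq> 0"
    using i0(2) by (metis complex_eq_iff zero_complex.sel)
  have "vec n (\<lambda>i. f (z $ i)) \<noteq> 0\<^sub>v n"
    using f(2) i0(1) by (metis index_vec index_zero_vec(1))
  then have "eigenvector A (vec n (\<lambda>i. f (z $ i))) \<kappa>"
    using part[OF f(1)] A by (simp add: eigenvector_def)
  then show ?thesis unfolding eigenvalue_def by blast
qed

text \<open>Together with finiteness this makes the \<open>Max\<close> in
  \<open>graph_spectral_radius\<close> an actual eigenvalue.\<close>

lemma adjacency_eigenvalues_nonempty: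
  assumes "pair_graph G" and "pverts G \<noteq> {}"
  shows "adjacency_eigenvalues G \<noteq> {}"
proof -
  interpret G: pair_graph G by fact
  obtain vs where vs: "set vs = pverts G" "distinct vs"
    using finite_distinct_list[OF G.pair_finite_verts] by blast
  have "\<exists>k. eigenvalue (adjacency_mat G vs) k"
  proof (rule real_symmetric_mat_has_eigenvalue)
    show "adjacency_mat G vs \<in> carrier_mat (length vs) (length vs)"
      by (simp add: adjacency_mat_def)
    show "length vs > 0" using vs assms(2) by auto
    fix i j assume "i < length vs" "j < length vs"
    then show "adjacency_mat G vs $$ (i, j) = adjacency_mat G vs $$ (j, i)"
      by (auto simp: adjacency_mat_def dest: G.arcs_symmetric)
  qed
  then show ?thesis using vs by (simp add: adjacency_eigenvalues_eq)
qed

lemma spectral_radius_in_adjacency_eigenvalues: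
  assumes "pair_graph G" and "pverts G \<noteq> {}"
  shows "graph_spectral_radius G \<in> adjacency_eigenvalues G"
  unfolding graph_spectral_radius_def
  using finite_adjacency_eigenvalues[OF assms(1)] adjacency_eigenvalues_nonempty[OF assms]
  by (rule Max_in)

lemma adjacency_eigenvalue_le_spectral_radius:
  assumes "pair_graph G" and "k \<in> adjacency_eigenvalues G"
  shows "k \<le> graph_spectral_radius G"
  unfolding graph_spectral_radius_def
  using finite_adjacency_eigenvalues[OF assms(1)] assms(2) by (rule Max_ge)

section \<open>Comparing eigenvalues by positive vectors\<close>

text \<open>In a symmetric digraph connectedness is strong connectedness, so every vertex is
  reachable from a vertex of \<open>M\<close>, and walks cannot leave \<open>M\<close>.\<close>

lemma connected_closed_eq:
  assumes "pair_graph G" and "connected (with_proj G)"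
    and "M \<subseteq> pverts G" and "M \<noteq> {}"
    and closed: "\<And>v w. v \<in> M \<Longrightarrow> (v, w) \<in> parcs G \<Longrightarrow> w \<in> M"
  shows "M = pverts G"
proof -
  interpret G: pair_graph G by fact
  obtain u where u: "u \<in> M" using assms(4) by blast
  have "strongly_connected (with_proj G)"
    using G.sym_arcs assms(2) by (rule G.symmetric_connected_imp_strongly_connected)
  then have reach: "u \<rightarrow>\<^sup>*\<^bsub>with_proj G\<^esub> v" if "v \<in> pverts G" for v
    using that u assms(3) by (auto simp: strongly_connected_def)
  have "v \<in> M" if "u \<rightarrow>\<^sup>*\<^bsub>with_proj G\<^esub> v" for v
    using that by (induction rule: G.reachable_induct) (use u closed in auto)
  then show ?thesis using reach assms(3) by blast
qed

text \<open>At a vertex maximizing \<open>\<bar>y v\<bar> / x v\<close> the eigenvalue equation for \<open>y\<close> is dominated by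
  the inequality for \<open>x\<close>; in case of equality the maximum is also attained at all neighbours.\<close>

lemma
  assumes "pair_graph G" and "k \<in> adjacency_eigenvalues G"
    and pos: "\<And>v. v \<in> pverts G \<Longrightarrow> x v > 0"
    and sub: "\<And>v. v \<in> pverts G \<Longrightarrow>
      (\<Sum>w\<in>pverts G. if (v, w) \<in> parcs G then x w else 0) \<le> l * x v"
  shows eigenvalue_le_of_subharmonic: "k \<le> l"
    and eigenvalue_eq_imp_harmonic: "k = l \<Longrightarrow> connected (with_proj G) \<Longrightarrow> v \<in> pverts G \<Longrightarrow>
      (\<Sum>w\<in>pverts G. if (v, w) \<in> parcs G then x w else 0) = l * x v"
proof -
  interpret G: pair_graph G by fact
  let ?V = "pverts G"
  have finV: "finite ?V" by simp
  obtain y where y0: "\<exists>v\<in>?V. y v \<noteq> 0"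
    and y: "\<And>v. v \<in> ?V \<Longrightarrow> (\<Sum>w\<in>?V. if (v, w) \<in> parcs G then y w else 0) = k * y v"
    using assms(2) unfolding adjacency_eigenvalues_iff[OF assms(1)] by blast
  define t where "t = Max ((\<lambda>v. \<bar>y v\<bar> / x v) ` ?V)"
  have ratio: "\<bar>y v\<bar> / x v \<le> t" if "v \<in> ?V" for v
    unfolding t_def using finV that by (intro Max_ge) auto
  have le: "\<bar>y v\<bar> \<le> t * x v" if "v \<in> ?V" for v
    using ratio[OF that] pos[OF that] by (simp add: pos_divide_le_eq)
  have "t > 0"
  proof -
    obtain v where v: "v \<in> ?V" "y v \<noteq> 0" using y0 by blast
    then have "0 < t * x v" using le[OF v(1)] by simp
    then show ?thesis using pos[OF v(1)] by (simp add: zero_less_mult_iff)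
  qed
  \<comment> \<open>The vertices at which the maximal ratio \<open>t\<close> is attained.\<close>
  define M where "M = {v \<in> ?V. \<bar>y v\<bar> = t * x v}"
  have "t \<in> (\<lambda>v. \<bar>y v\<bar> / x v) ` ?V"
    unfolding t_def using finV y0 by (intro Max_in) auto
  then obtain v0 where "v0 \<in> ?V" "t = \<bar>y v0\<bar> / x v0" by blast
  then have v0: "v0 \<in> M" using pos[of v0] by (simp add: M_def)
  let ?S = "\<lambda>f v. \<Sum>w\<in>?V. if (v, w) \<in> parcs G then f w else (0::real)"
  \<comment> \<open>In order: the eigenvalue equation with the triangle inequality, the bound
    \<open>\<bar>y w\<bar> \<le> t * x w\<close>, and the hypothesis on \<open>x\<close>.\<close>
  have chain: "k * (t * x v) \<le> ?S (\<lambda>w. \<bar>y w\<bar>) v" "?S (\<lambda>w. \<bar>y w\<bar>) v \<le> t * ?S x v"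
    "t * ?S x v \<le> l * (t * x v)" if "v \<in> M" for v
  proof -
    have v: "v \<in> ?V" "\<bar>y v\<bar> = t * x v" using that by (auto simp: M_def)
    have "k * (t * x v) \<le> \<bar>k * y v\<bar>"
      unfolding abs_mult v(2)[symmetric] by (intro mult_right_mono) auto
    also have "\<dots> = \<bar>\<Sum>w\<in>?V. if (v, w) \<in> parcs G then y w else 0\<bar>" using y[OF v(1)] by simp
    also have "\<dots> \<le> (\<Sum>w\<in>?V. \<bar>if (v, w) \<in> parcs G then y w else 0\<bar>)" by (rule sum_abs)
    also have "\<dots> = ?S (\<lambda>w. \<bar>y w\<bar>) v" by (intro sum.cong) auto
    finally show "k * (t * x v) \<le> ?S (\<lambda>w. \<bar>y w\<bar>) v" .
    have "t * ?S x v = ?S (\<lambda>w. t * x w) v"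
      unfolding sum_distrib_left by (intro sum.cong) auto
    then show "?S (\<lambda>w. \<bar>y w\<bar>) v \<le> t * ?S x v"
      using le by (auto intro!: sum_mono)
    show "t * ?S x v \<le> l * (t * x v)"
      using mult_left_mono[OF sub[OF v(1)], of t] \<open>t > 0\<close> by (simp add: mult.left_commute)
  qed
  have "k * (t * x v0) \<le> l * (t * x v0)" using chain[OF v0] by linarith
  moreover have "t * x v0 > 0" using v0 pos \<open>t > 0\<close> by (simp add: M_def)
  ultimately show "k \<le> l" by (rule mult_right_le_imp_le)
  assume eq: "k = l" and con: "connected (with_proj G)" and v: "v \<in> ?V"
  \<comment> \<open>For \<open>k = l\<close> the chain collapses to equalities, so the nonnegative
    gaps \<open>t * x w - \<bar>y w\<bar>\<close> over the neighbours of \<open>u\<close> sum to 0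
    and each of them vanishes.\<close>
  have closed: "w \<in> M" if u: "u \<in> M" and uw: "(u, w) \<in> parcs G" for u w
  proof -
    have "?S (\<lambda>w. t * x w - \<bar>y w\<bar>) u = t * ?S x u - ?S (\<lambda>w. \<bar>y w\<bar>) u"
      unfolding sum_distrib_left sum_subtractf[symmetric] by (intro sum.cong) auto
    also have "\<dots> = 0" using chain[OF u] unfolding eq by linarith
    finally have "\<forall>w\<in>?V. (if (u, w) \<in> parcs G then t * x w - \<bar>y w\<bar> else 0) = 0"
      using le finV by (subst (asm) sum_nonneg_eq_0_iff) auto
    moreover have "w \<in> ?V" using uw by (rule G.in_arcsD2)
    ultimately have "t * x w - \<bar>y w\<bar> = 0" using uw by (auto dest: bspec[of _ _ w])
    then show ?thesis using \<open>w \<in> ?V\<close> by (simp add: M_def)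
  qed
  have "M \<subseteq> ?V" "M \<noteq> {}" using v0 by (auto simp: M_def)
  then have "M = ?V" using closed by (rule connected_closed_eq[OF assms(1) con])
  then have "v \<in> M" using v by simp
  then have "t * ?S x v = l * (t * x v)" using chain[of v] unfolding eq by linarith
  then have "t * ?S x v = t * (l * x v)" by (simp add: mult.left_commute)
  then show "?S x v = l * x v" using \<open>t > 0\<close> by simp
qed

text \<open>For a partition of the vertices into \<open>T\<close>, \<open>R\<close> and \<open>I\<close>, these are the edges of the join of
  a complete graph on \<open>T\<close> with the disjoint union of a complete graph on \<open>R\<close> and isolated
  vertices \<open>I\<close>.\<close>

definition join_adj :: "'a set \<Rightarrow> 'a set \<Rightarrow> 'a \<Rightarrow> 'a \<Rightarrow> bool" where
  "join_adj T I v w \<longleftrightarrow> v \<noteq> w \<and> (v \<in> I \<longrightarrow> w \<in> T) \<and> (w \<in> I \<longrightarrow> v \<in> T)"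

definition tripartition :: "'a set \<Rightarrow> 'a set \<Rightarrow> 'a set \<Rightarrow> 'a set \<Rightarrow> bool" where
  "tripartition V T R I \<longleftrightarrow>
    V = T \<union> R \<union> I \<and> T \<inter> R = {} \<and> T \<inter> I = {} \<and> R \<inter> I = {}"

section \<open>Weights constant on the three parts\<close>

definition join_weight :: "'a set \<Rightarrow> 'a set \<Rightarrow> real \<Rightarrow> real \<Rightarrow> 'a \<Rightarrow> real" where
  "join_weight T I b c w = (if w \<in> T then 1 else if w \<in> I then c else b)"

text \<open>The partition is equitable, so the sums are the rows of its 3 by 3 quotient matrix
  applied to the weights \<open>1\<close>, \<open>b\<close>, \<open>c\<close> of \<open>T\<close>,
  \<open>R\<close>, \<open>I\<close>. The subtracted 1 is the vertex itself, missing from its own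
  neighbourhood in a clique.\<close>

lemma sum_join_weight:
  assumes "finite V" and "tripartition V T R I" and "v \<in> V"
  shows "(\<Sum>w\<in>V. if join_adj T I v w then join_weight T I b c w else 0) =
    (if v \<in> T then real (card T) - 1 + real (card R) * b + real (card I) * c
     else if v \<in> I then real (card T)
     else real (card T) + (real (card R) - 1) * b)"
proof -
  have V: "V = T \<union> R \<union> I" "T \<inter> R = {}" "T \<inter> I = {}" "R \<inter> I = {}"
    using assms(2) by (auto simp: tripartition_def)
  have fin: "finite T" "finite R" "finite I" using assms(1) V(1) by auto
  have split: "(\<Sum>w\<in>V. f w) = (\<Sum>w\<in>T. f w) + (\<Sum>w\<in>R. f w) + (\<Sum>w\<in>I. f w)" for f :: "'a \<Rightarrow> real"
    unfolding V(1) using V fin by (subst sum.union_disjoint; auto)+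
  have del: "(\<Sum>w\<in>X. if v \<noteq> w then d else 0) = (real (card X) - 1) * d"
    if "v \<in> X" "finite X" for X and d :: real
  proof -
    have "(\<Sum>w\<in>X. if v \<noteq> w then d else 0) = (\<Sum>w\<in>X - {v}. d)"
      using that by (intro sum.mono_neutral_cong_right) auto
    then show ?thesis using that by (cases "card X") (auto simp: card_gt_0_iff)
  qed
  have T: "(\<Sum>w\<in>T. if join_adj T I v w then join_weight T I b c w else 0) =
      (if v \<in> T then real (card T) - 1 else real (card T))"
  proof (cases "v \<in> T")
    case True
    have "(\<Sum>w\<in>T. if join_adj T I v w then join_weight T I b c w else 0) = (\<Sum>w\<in>T. if v \<noteq> w then 1 else 0)"
      using V True by (intro sum.cong) (auto simp: join_adj_def join_weight_def)
    with del[OF True fin(1), of 1] True show ?thesis by simp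
  next
    case False
    have "(\<Sum>w\<in>T. if join_adj T I v w then join_weight T I b c w else 0) = (\<Sum>w\<in>T. 1)"
      using V False by (intro sum.cong) (auto simp: join_adj_def join_weight_def)
    with False show ?thesis by simp
  qed
  have R: "(\<Sum>w\<in>R. if join_adj T I v w then join_weight T I b c w else 0) =
      (if v \<in> T then real (card R) * b else if v \<in> I then 0 else (real (card R) - 1) * b)"
  proof (cases "v \<in> R")
    case True
    have "(\<Sum>w\<in>R. if join_adj T I v w then join_weight T I b c w else 0) = (\<Sum>w\<in>R. if v \<noteq> w then b else 0)"
      using V True by (intro sum.cong) (auto simp: join_adj_def join_weight_def)
    moreover have "v \<notin> T" "v \<notin> I" using True V by auto
    ultimately show ?thesis using del[OF True fin(2), of b] by simp
  next
    case False
    have "(\<Sum>w\<in>R. if join_adj T I v w then join_weight T I b c w else 0) = (\<Sum>w\<in>R. if v \<in> T then b else 0)"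
      using V False assms(3) by (intro sum.cong) (auto simp: join_adj_def join_weight_def)
    moreover have "v \<in> T \<or> v \<in> I" using False V assms(3) by auto
    ultimately show ?thesis by auto
  qed
  have I: "(\<Sum>w\<in>I. if join_adj T I v w then join_weight T I b c w else 0) =
      (if v \<in> T then real (card I) * c else 0)"
  proof -
    have "(\<Sum>w\<in>I. if join_adj T I v w then join_weight T I b c w else 0) = (\<Sum>w\<in>I. if v \<in> T then c else 0)"
      using V by (intro sum.cong) (auto simp: join_adj_def join_weight_def)
    then show ?thesis by auto
  qed
  show ?thesis unfolding split T R I by auto
qed

text \<open>The last three assumptions are the inequality for \<open>join_weight\<close> on
  \<open>T\<close>, \<open>I\<close> and \<open>R\<close> in the full join. Passing to a subgraph
  only drops positive terms, so the inequality holds for \<open>G\<close> as well.\<close>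

lemma
  assumes "pair_graph G" and "pverts G \<noteq> {}" and part: "tripartition (pverts G) T R I"
    and adj: "\<And>v w. (v, w) \<in> parcs G \<Longrightarrow> join_adj T I v w"
    and "b > 0" and "c > 0"
    and T: "real (card T) - 1 + real (card R) * b + real (card I) * c \<le> l"
    and I: "real (card T) \<le> l * c"
    and R: "R \<noteq> {} \<Longrightarrow> real (card T) + (real (card R) - 1) * b \<le> l * b"
  shows spectral_radius_le_join: "graph_spectral_radius G \<le> l"
    and spectral_radius_eq_imp_join: "graph_spectral_radius G \<ge> l \<Longrightarrow> connected (with_proj G) \<Longrightarrow>
      v \<in> pverts G \<Longrightarrow> w \<in> pverts G \<Longrightarrow> join_adj T I v w \<Longrightarrow> (v, w) \<in> parcs G"
proof -
  interpret G: pair_graph G by fact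
  let ?V = "pverts G" and ?x = "join_weight T I b c"
  have finV: "finite ?V" by simp
  have pos: "?x v > 0" for v using \<open>b > 0\<close> \<open>c > 0\<close> by (simp add: join_weight_def)
  have full: "(\<Sum>w\<in>?V. if join_adj T I v w then ?x w else 0) \<le> l * ?x v" if "v \<in> ?V" for v
  proof -
    have "v \<in> T \<or> v \<in> R \<and> v \<notin> T \<and> v \<notin> I \<or> v \<in> I \<and> v \<notin> T"
      using part that by (auto simp: tripartition_def)
    then show ?thesis
      unfolding sum_join_weight[OF finV part that] using T I R
      by (auto simp: join_weight_def)
  qed
  have le: "(\<Sum>w\<in>?V. if (v, w) \<in> parcs G then ?x w else 0)
      \<le> (\<Sum>w\<in>?V. if join_adj T I v w then ?x w else 0)" for v
    using adj pos by (intro sum_mono) (auto intro: less_imp_le)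
  have sub: "(\<Sum>w\<in>?V. if (v, w) \<in> parcs G then ?x w else 0) \<le> l * ?x v" if "v \<in> ?V" for v
    using le full[OF that] by (rule order_trans)
  note bound = assms(1) spectral_radius_in_adjacency_eigenvalues[OF assms(1,2)] pos sub
  show rho: "graph_spectral_radius G \<le> l"
    by (rule eigenvalue_le_of_subharmonic[OF bound])
  assume "graph_spectral_radius G \<ge> l" and con: "connected (with_proj G)"
    and vw: "v \<in> ?V" "w \<in> ?V" "join_adj T I v w"
  then have "(\<Sum>w\<in>?V. if (v, w) \<in> parcs G then ?x w else 0) = l * ?x v"
    using rho by (intro eigenvalue_eq_imp_harmonic[OF bound]) auto
  then have eq: "(\<Sum>w\<in>?V. if (v, w) \<in> parcs G then ?x w else 0)
      = (\<Sum>w\<in>?V. if join_adj T I v w then ?x w else 0)"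
    using le[of v] full[OF vw(1)] by linarith
  show "(v, w) \<in> parcs G"
  proof (rule ccontr)
    \<comment> \<open>A missing edge would drop a strictly positive term from the sum at
      \<open>v\<close>.\<close>
    assume "(v, w) \<notin> parcs G"
    then have "(\<Sum>w\<in>?V. if (v, w) \<in> parcs G then ?x w else 0)
        < (\<Sum>w\<in>?V. if join_adj T I v w then ?x w else 0)"
      using adj pos finV vw
      by (intro sum_strict_mono_ex1 bexI[of _ w]) (auto intro: less_imp_le)
    then show False using eq by simp
  qed
qed

text \<open>With equalities on all parts of a full join, \<open>join_weight\<close> is an
  eigenvector for \<open>l\<close>; it is nonzero because it equals 1 on the nonempty
  \<open>T\<close>.\<close>

lemma join_le_spectral_radius:
  assumes "pair_graph G" and part: "tripartition (pverts G) T R I" and "T \<noteq> {}"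
    and adj: "\<And>v w. v \<in> pverts G \<Longrightarrow> w \<in> pverts G \<Longrightarrow> (v, w) \<in> parcs G \<longleftrightarrow> join_adj T I v w"
    and T: "real (card T) - 1 + real (card R) * b + real (card I) * c = l"
    and I: "real (card T) = l * c"
    and R: "R \<noteq> {} \<Longrightarrow> real (card T) + (real (card R) - 1) * b = l * b"
  shows "l \<le> graph_spectral_radius G"
proof (rule adjacency_eigenvalue_le_spectral_radius[OF assms(1)])
  interpret G: pair_graph G by fact
  let ?V = "pverts G" and ?x = "join_weight T I b c"
  have finV: "finite ?V" by simp
  have "(\<Sum>w\<in>?V. if (v, w) \<in> parcs G then ?x w else 0) = l * ?x v" if "v \<in> ?V" for v
  proof -
    have "(\<Sum>w\<in>?V. if (v, w) \<in> parcs G then ?x w else 0)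
        = (\<Sum>w\<in>?V. if join_adj T I v w then ?x w else 0)"
      using adj that by (intro sum.cong) auto
    moreover have "v \<in> T \<or> v \<in> R \<and> v \<notin> T \<and> v \<notin> I \<or> v \<in> I \<and> v \<notin> T"
      using part that by (auto simp: tripartition_def)
    ultimately show ?thesis
      unfolding sum_join_weight[OF finV part that] using T I R
      by (auto simp: join_weight_def)
  qed
  moreover have "\<exists>v\<in>?V. ?x v \<noteq> 0"
    using \<open>T \<noteq> {}\<close> part by (auto simp: tripartition_def join_weight_def)
  ultimately show "l \<in> adjacency_eigenvalues G"
    unfolding adjacency_eigenvalues_iff[OF assms(1)] by blast
qed

section \<open>The extremal graphs\<close>

text \<open>\<open>join_adj\<close> depends only on the parts of the two vertices and on their being
  distinct, so arbitrary bijections between corresponding parts glue to an isomorphism.\<close>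

lemma join_digraph_iso:
  assumes "pair_graph G" and "pair_graph H"
    and G: "tripartition (pverts G) T R I" and H: "tripartition (pverts H) T' R' I'"
    and card: "card T = card T'" "card R = card R'" "card I = card I'"
    and Gadj: "\<And>v w. v \<in> pverts G \<Longrightarrow> w \<in> pverts G \<Longrightarrow> (v, w) \<in> parcs G \<longleftrightarrow> join_adj T I v w"
    and Hadj: "\<And>v w. v \<in> pverts H \<Longrightarrow> w \<in> pverts H \<Longrightarrow> (v, w) \<in> parcs H \<longleftrightarrow> join_adj T' I' v w"
  shows "digraph_iso (with_proj G) (with_proj H)"
proof -
  interpret G: pair_graph G by fact
  interpret H: pair_graph H by fact
  have V: "pverts G = T \<union> R \<union> I" "T \<inter> R = {}" "T \<inter> I = {}" "R \<inter> I = {}"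
    and V': "pverts H = T' \<union> R' \<union> I'" "T' \<inter> R' = {}" "T' \<inter> I' = {}" "R' \<inter> I' = {}"
    using G H by (auto simp: tripartition_def)
  have fin: "finite T" "finite R" "finite I" "finite T'" "finite R'" "finite I'"
    using G.pair_finite_verts H.pair_finite_verts V(1) V'(1) by auto
  obtain f g h where fgh: "bij_betw f T T'" "bij_betw g R R'" "bij_betw h I I'"
    using fin card by (metis finite_same_card_bij)
  define F where "F x = (if x \<in> T then f x else if x \<in> I then h x else g x)" for x
  have FT: "bij_betw F T T'"
    using fgh(1) by (rule bij_betw_cong[THEN iffD1, rotated]) (simp add: F_def)
  have FR: "bij_betw F R R'"
    using fgh(2) by (rule bij_betw_cong[THEN iffD1, rotated]) (use V in \<open>auto simp: F_def\<close>)
  have FI: "bij_betw F I I'"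
    using fgh(3) by (rule bij_betw_cong[THEN iffD1, rotated]) (use V in \<open>auto simp: F_def\<close>)
  have F: "bij_betw F (pverts G) (pverts H)"
    unfolding V V' using V'
    by (intro bij_betw_combine FT FR FI) auto
  have mem: "F u \<in> T' \<longleftrightarrow> u \<in> T" "F u \<in> I' \<longleftrightarrow> u \<in> I" if "u \<in> pverts G" for u
  proof -
    have "u \<in> T \<Longrightarrow> F u \<in> T'" "u \<in> R \<Longrightarrow> F u \<in> R'" "u \<in> I \<Longrightarrow> F u \<in> I'"
      using FT FR FI by (simp_all add: bij_betw_apply)
    moreover have "u \<in> T \<or> u \<in> R \<or> u \<in> I" using that V(1) by blast
    ultimately show "F u \<in> T' \<longleftrightarrow> u \<in> T" "F u \<in> I' \<longleftrightarrow> u \<in> I" using V(2-4) V'(2-4) by blast+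
  qed
  show ?thesis
  proof (rule digraph_iso_with_projI[OF G.pair_wf_digraph H.pair_wf_digraph F])
    fix u v assume uv: "u \<in> pverts G" "v \<in> pverts G"
    then have "F u \<in> pverts H" "F v \<in> pverts H" using F by (auto dest: bij_betwE)
    moreover have "F u = F v \<longleftrightarrow> u = v"
      using F uv by (auto simp: bij_betw_def inj_on_eq_iff)
    ultimately show "(u, v) \<in> parcs G \<longleftrightarrow> (F u, F v) \<in> parcs H"
      using uv by (simp add: Gadj Hadj join_adj_def mem)
  qed
qed

lemma card_tripartition:
  assumes "finite V" and "tripartition V T R I"
  shows "card V = card T + card R + card I"
proof -
  have "V = T \<union> R \<union> I" "T \<inter> R = {}" "(T \<union> R) \<inter> I = {}"
    using assms(2) by (auto simp: tripartition_def)
  with assms(1) show ?thesis by (simp add: card_Un_disjoint)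
qed

lemma parcs_graph_union_iff:
  "(Inl a, Inl b) \<in> parcs (graph_union G H) \<longleftrightarrow> (a, b) \<in> parcs G"
  "(Inr c, Inr d) \<in> parcs (graph_union G H) \<longleftrightarrow> (c, d) \<in> parcs H"
  "(Inl a, Inr d) \<notin> parcs (graph_union G H)"
  "(Inr c, Inl b) \<notin> parcs (graph_union G H)"
  by (force simp: graph_union_def)+

lemma parcs_graph_join_iff:
  "(Inl a, Inl b) \<in> parcs (graph_join G H) \<longleftrightarrow> (a, b) \<in> parcs G"
  "(Inr c, Inr d) \<in> parcs (graph_join G H) \<longleftrightarrow> (c, d) \<in> parcs H"
  "(Inl a, Inr d) \<in> parcs (graph_join G H) \<longleftrightarrow> a \<in> pverts G \<and> d \<in> pverts H"
  "(Inr c, Inl b) \<in> parcs (graph_join G H) \<longleftrightarrow> c \<in> pverts H \<and> b \<in> pverts G"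
  by (auto simp: graph_join_def parcs_graph_union_iff)

lemma pair_graph_kite:
  "pair_graph (graph_join (complete_graph 1) (graph_union (complete_graph m) (complete_graph 1)))"
  by (intro pair_graph_graph_join pair_graph_graph_union pair_graph_complete_graph)

text \<open>This graph is a clique with a pendant vertex: \<open>I\<close> is the pendant vertex,
  \<open>T\<close> its neighbour, and \<open>R\<close> the rest of the clique.\<close>

lemma kite_tripartition:
  fixes m :: nat
  defines "H \<equiv> graph_join (complete_graph 1) (graph_union (complete_graph m) (complete_graph 1))"
    and "T \<equiv> {Inl 0}" and "R \<equiv> Inr ` Inl ` {..<m}" and "I \<equiv> {Inr (Inr 0)}"
  shows "tripartition (pverts H) T R I"
    and "card T = 1" and "card R = m" and "card I = 1"
    and "v \<in> pverts H \<Longrightarrow> w \<in> pverts H \<Longrightarrow> (v, w) \<in> parcs H \<longleftrightarrow> join_adj T I v w"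
proof -
  show "tripartition (pverts H) T R I"
    by (auto simp: assms graph_join_def graph_union_def complete_graph_def tripartition_def Plus_def)
  show "card T = 1" "card R = m" "card I = 1"
    by (auto simp: assms card_image)
  show "(v, w) \<in> parcs H \<longleftrightarrow> join_adj T I v w" if "v \<in> pverts H" "w \<in> pverts H"
  proof -
    have V: "pverts H = insert (Inl 0) (insert (Inr (Inr 0)) (Inr ` Inl ` {..<m}))"
      by (auto simp: H_def graph_join_def graph_union_def complete_graph_def Plus_def)
    show ?thesis
      using that[unfolded V] unfolding H_def T_def I_def
      by (elim insertE imageE; simp add: parcs_graph_join_iff parcs_graph_union_iff join_adj_def)
        (auto simp: complete_graph_def graph_union_def)
  qed
qed

lemma pair_graph_complete_split:
  "pair_graph (graph_join (complete_graph m) (empty_graph m))"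
  by (intro pair_graph_graph_join pair_graph_complete_graph pair_graph_empty_graph)

lemma complete_split_tripartition:
  fixes m :: nat
  defines "H \<equiv> graph_join (complete_graph m) (empty_graph m)"
    and "T \<equiv> Inl ` {..<m}" and "I \<equiv> Inr ` {..<m}"
  shows "tripartition (pverts H) T {} I"
    and "card T = m" and "card I = m"
    and "v \<in> pverts H \<Longrightarrow> w \<in> pverts H \<Longrightarrow> (v, w) \<in> parcs H \<longleftrightarrow> join_adj T I v w"
proof -
  show "tripartition (pverts H) T {} I"
    by (auto simp: assms graph_join_def complete_graph_def empty_graph_def tripartition_def Plus_def)
  show "card T = m" "card I = m"
    by (auto simp: assms card_image)
  show "(v, w) \<in> parcs H \<longleftrightarrow> join_adj T I v w" if "v \<in> pverts H" "w \<in> pverts H"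
  proof -
    have V: "pverts H = Inl ` {..<m} \<union> Inr ` {..<m}"
      by (auto simp: H_def graph_join_def complete_graph_def empty_graph_def Plus_def)
    show ?thesis
      using that[unfolded V] unfolding H_def T_def I_def
      by (elim UnE imageE; simp add: parcs_graph_join_iff join_adj_def)
        (auto simp: complete_graph_def empty_graph_def)
  qed
qed

section \<open>The spectral condition\<close>

text \<open>An independent set \<open>J\<close> of \<open>G - v\<close> with fewer than
  \<open>card J\<close> neighbours exists. Putting \<open>v\<close> among the neighbours gives
  \<open>T\<close>, still of size at most \<open>card J\<close>, and \<open>J\<close> is trimmed to
  a set \<open>I\<close> of size \<open>card T\<close>.\<close>

lemma no_factor_imp_tripartition:
  assumes "pair_graph G" and "v \<in> pverts G"
    and "\<not> has_K2_cycle_factor (pre_digraph.del_vert (with_proj G) v)"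
  obtains T R I where "tripartition (pverts G) T R I" and "T \<noteq> {}" and "card T = card I"
    and "\<And>u w. (u, w) \<in> parcs G \<Longrightarrow> join_adj T I u w"
proof -
  interpret G: pair_graph G by fact
  define H where "H = \<lparr> pverts = pverts G - {v}, parcs = {e \<in> parcs G. fst e \<noteq> v \<and> snd e \<noteq> v} \<rparr>"
  have H: "with_proj H = pre_digraph.del_vert (with_proj G) v"
    by (simp add: H_def with_proj_def pre_digraph.del_vert_def)
  have "pair_graph H"
    by unfold_locales
      (auto simp: H_def symmetric_def intro!: symI dest: G.wellformed' G.no_loops' G.arcs_symmetric)
  moreover have "\<not> has_K2_cycle_factor (with_proj H)" unfolding H by (rule assms(3))
  ultimately obtain J where J: "J \<subseteq> pverts H" "\<And>u w. u \<in> J \<Longrightarrow> w \<in> J \<Longrightarrow> (u, w) \<notin> parcs H"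
    "card (parcs H `` J) < card J"
    by (rule no_K2_cycle_factor_imp_independent) (rule that)
  \<comment> \<open>Adding \<open>v\<close> captures the edges of \<open>G\<close> at
    \<open>J\<close> that the deletion removed, and makes \<open>T\<close> nonempty.\<close>
  define T where "T = insert v (parcs H `` J)"
  have "finite (parcs H `` J)"
    by (rule finite_subset[OF _ G.pair_finite_verts]) (auto simp: H_def dest: G.wellformed')
  then have "card T \<le> card J" using J(3) by (simp add: T_def card_insert_if)
  then obtain I where I: "I \<subseteq> J" "card I = card T" by (metis obtain_subset_with_card_n)
  have TI: "T \<inter> I = {}" using I(1) J(1,2) by (auto simp: T_def H_def)
  define R where "R = pverts G - T - I"
  have TV: "T \<subseteq> pverts G" using assms(2) by (auto simp: T_def H_def dest: G.wellformed')
  have IV: "I \<subseteq> pverts G" using I(1) J(1) by (auto simp: H_def)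
  have nbr: "w \<in> T" if "u \<in> I" "(u, w) \<in> parcs G" for u w
  proof (cases "w = v")
    case False
    have "u \<in> J" "u \<noteq> v" using that(1) I(1) J(1) by (auto simp: H_def)
    then have "(u, w) \<in> parcs H" using that(2) False by (simp add: H_def)
    then show ?thesis using \<open>u \<in> J\<close> by (auto simp: T_def)
  qed (simp add: T_def)
  show ?thesis
  proof (rule that)
    show "tripartition (pverts G) T R I"
      using TI TV IV by (auto simp: tripartition_def R_def)
    show "T \<noteq> {}" by (simp add: T_def)
    show "card T = card I" using I(2) by simp
    show "join_adj T I u w" if "(u, w) \<in> parcs G" for u w
      using that nbr G.arcs_symmetric by (auto simp: join_adj_def dest: G.no_loops')
  qed
qed

section \<open>Numerical estimates and the two extremal cases\<close>

text \<open>For \<open>x = n\<close> this is the quotient equation of the kite after eliminating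
  \<open>b = 1 / (l - n + 3)\<close> and \<open>c = 1 / l\<close>. The difference \<open>g\<close>
  of its sides changes sign on \<open>{x - 2..x}\<close>, and \<open>g (x - 2) < 0\<close> makes the
  lower bound strict.\<close>

lemma kite_eigenvalue_equation:
  fixes x :: real
  assumes "x \<ge> 3"
  obtains l where "l > x - 2" and "l = (x - 2) / (l - x + 3) + 1 / l"
proof -
  define g where "g y = y - (x - 2) / (y - x + 3) - 1 / y" for y :: real
  have "\<exists>l\<ge>x - 2. l \<le> x \<and> g l = 0"
  proof (rule IVT')
    show "g (x - 2) \<le> 0" using assms by (simp add: g_def)
    have "(x - 2) / 3 + 1 / x \<le> (x - 2) / 3 + 1 / 3"
      using assms by (intro add_left_mono divide_left_mono) auto
    also have "\<dots> \<le> x" using assms by (simp add: field_simps)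
    finally show "0 \<le> g x" by (simp add: g_def)
    show "continuous_on {x - 2..x} g"
      unfolding g_def by (intro continuous_intros) (use assms in auto)
  qed simp
  then obtain l where l: "l \<ge> x - 2" "g l = 0" by blast
  have "g (x - 2) < 0" using assms by (simp add: g_def)
  with l have "l \<noteq> x - 2" by auto
  with l that[of l] show ?thesis by (simp add: g_def)
qed

text \<open>For \<open>s \<ge> 2\<close> the weight on \<open>R\<close> is at most
  \<open>2 / 3\<close>, and \<open>quad\<close> bounds the last summand by
  \<open>(n - 3 + s) / 3\<close>; the resulting bounds add up to exactly
  \<open>n - 2\<close>.\<close>

lemma join_weight_inequality:
  fixes s r :: nat
  defines "n \<equiv> 2 * s + r"
  assumes "s \<ge> 2" and "n \<ge> 7 \<or> n = 5"
  shows "real s - 1 + real r * (real s / (2 * real s - 1)) + real s * (real s / (real n - 2)) \<le> real n - 2"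
proof -
  obtain u where u: "s = u + 2" using \<open>s \<ge> 2\<close> by (metis le_add_diff_inverse2)
  have n: "real n - 2 > 0" using assms(2) by (simp add: n_def)
  \<comment> \<open>This is \<open>quad\<close> expanded with \<open>s = u + 2\<close>. For
    \<open>r = 0\<close> the order is even, so it is at least 8 and \<open>u \<ge> 2\<close>; for
    \<open>r \<ge> 1\<close> the terms \<open>5 * r + r * r\<close> suffice.\<close>
  have "6 \<le> 3 * (u * u) + 5 * r + 5 * (u * r) + r * r"
  proof (cases "r = 0")
    case True
    then have "u \<ge> 2" using assms(3) by (auto simp: n_def u)
    then have "2 * 2 \<le> u * u" by (intro mult_le_mono) auto
    then show ?thesis by simp
  next
    case False
    then have "1 \<le> r" "1 * 1 \<le> r * r" by (auto intro!: mult_le_mono)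
    then show ?thesis by linarith
  qed
  then have "real 6 \<le> real (3 * (u * u) + 5 * r + 5 * (u * r) + r * r)"
    by (subst of_nat_le_iff)
  then have quad: "3 * (real s * real s) \<le> (real n - 2) * (real n - 3 + real s)"
    by (simp add: n_def u algebra_simps)
  have "real s / (2 * real s - 1) \<le> 2 / 3"
    using assms(2) by (simp add: divide_le_eq)
  then have "real r * (real s / (2 * real s - 1)) \<le> real r * (2 / 3)"
    by (intro mult_left_mono) auto
  moreover have "real s * (real s / (real n - 2)) \<le> (real n - 3 + real s) / 3"
    using quad n by (simp add: divide_le_eq mult.commute)
  moreover have "real s - 1 + real r * (2 / 3) + (real n - 3 + real s) / 3 = real n - 2"
    by (simp add: n_def field_simps)
  ultimately show ?thesis by linarith
qed

text \<open>If \<open>card T = 1\<close>, then \<open>G\<close> is a spanning subgraph of the kite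
  and the equality case makes it the kite. If \<open>card T \<ge> 2\<close>, the spectral radius of
  \<open>G\<close> is at most \<open>n - 2\<close>, strictly below that of the kite.\<close>

lemma kite_extremal:
  fixes G :: "'a pair_pre_digraph" and n :: nat
  defines "H \<equiv> graph_join (complete_graph 1) (graph_union (complete_graph (n - 2)) (complete_graph 1))"
  assumes "pair_graph G" and "connected (with_proj G)" and "card (pverts G) = n"
    and n: "n \<ge> 7 \<or> n = 3 \<or> n = 5"
    and rho: "graph_spectral_radius G \<ge> graph_spectral_radius H"
    and niso: "\<not> digraph_iso (with_proj G) (with_proj H)"
    and v: "v \<in> pverts G"
  shows "has_K2_cycle_factor (pre_digraph.del_vert (with_proj G) v)"
proof (rule ccontr)
  interpret G: pair_graph G by fact
  assume "\<not> ?thesis"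
  then obtain T R I where part: "tripartition (pverts G) T R I" and "T \<noteq> {}"
    and TI: "card T = card I" and adj: "\<And>u w. (u, w) \<in> parcs G \<Longrightarrow> join_adj T I u w"
    using no_factor_imp_tripartition[OF assms(2) v] by metis
  have ne: "pverts G \<noteq> {}" using v by blast
  have fin: "finite (pverts G)" by simp
  have "finite T" using part fin by (auto simp: tripartition_def)
  then have "card T > 0" using \<open>T \<noteq> {}\<close> by (simp add: card_gt_0_iff)
  have cn: "n = 2 * card T + card R"
    using card_tripartition[OF fin part] assms(4) TI by simp
  have n3: "real n \<ge> 3" using n by auto
  then have n2: "real (n - 2) = real n - 2" by simp
  obtain l where l: "l > real n - 2" "l = (real n - 2) / (l - real n + 3) + 1 / l"
    using kite_eigenvalue_equation[OF n3] .
  \<comment> \<open>The weights \<open>1\<close>, \<open>b\<close> and \<open>1 / l\<close> form an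
    eigenvector of the kite for \<open>l\<close>.\<close>
  define b where "b = 1 / (l - real n + 3)"
  have bc: "b > 0" "1 / l > 0" using l(1) n3 by (auto simp: b_def)
  have eqT: "(real n - 2) * b + 1 / l = l" using l(2) by (simp add: b_def)
  have eqR: "1 + (real n - 3) * b = l * b" using l(1) by (simp add: b_def field_simps)
  have eqI: "1 = l * (1 / l)" using l(1) n3 by simp
  note kite = kite_tripartition(1)[where m = "n - 2", folded H_def]
    kite_tripartition(5)[where m = "n - 2", folded H_def] kite_tripartition(2-4)
  have H: "pair_graph H" unfolding H_def by (rule pair_graph_kite)
  have "l \<le> graph_spectral_radius H"
    by (rule join_le_spectral_radius[OF H kite(1) _ kite(2), where b = b and c = "1 / l"])
      (use kite(3-5) eqT eqR eqI in \<open>auto simp: n2\<close>)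
  then have rho_l: "graph_spectral_radius G \<ge> l" using rho by simp
  show False
  proof (cases "card T = 1")
    case True
    then have R: "card R = n - 2" using cn by simp
    have "join_adj T I u w \<Longrightarrow> (u, w) \<in> parcs G" if "u \<in> pverts G" "w \<in> pverts G" for u w
      by (rule spectral_radius_eq_imp_join[OF assms(2) ne part adj bc _ _ _ rho_l assms(3) that])
        (use True TI R eqT eqR eqI in \<open>auto simp: n2\<close>)
    then have "(u, w) \<in> parcs G \<longleftrightarrow> join_adj T I u w" if "u \<in> pverts G" "w \<in> pverts G" for u w
      using adj that by blast
    then have "digraph_iso (with_proj G) (with_proj H)"
      using True TI R kite by (intro join_digraph_iso[OF assms(2) H part kite(1)]) auto
    then show False using niso by blast
  next
    case False
    then have s: "card T \<ge> 2" using \<open>card T > 0\<close> by simp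
    \<comment> \<open>\<open>n = 3\<close> cannot occur, since
      \<open>n = 2 * card T + card R \<ge> 4\<close>.\<close>
    then have n': "n \<ge> 7 \<or> n = 5" using n cn by auto
    \<comment> \<open>Weights that make the inequalities on \<open>R\<close> and \<open>I\<close> equalities for the bound \<open>n - 2\<close>.\<close>
    let ?s = "real (card T)"
    have pos: "?s / (2 * ?s - 1) > 0" "?s / (real n - 2) > 0" using s n3 by auto
    have "graph_spectral_radius G \<le> real n - 2"
    proof (rule spectral_radius_le_join[OF assms(2) ne part adj pos])
      show "?s - 1 + real (card R) * (?s / (2 * ?s - 1)) + real (card I) * (?s / (real n - 2)) \<le> real n - 2"
        using join_weight_inequality[of "card T" "card R"] s n' cn TI by simp
      show "?s \<le> (real n - 2) * (?s / (real n - 2))" using n3 by simp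
      have "(2 * ?s - 1) * (?s / (2 * ?s - 1)) = ?s" using s by simp
      moreover have "real n - 2 = (2 * ?s - 1) + (real (card R) - 1)" using cn by simp
      ultimately show "?s + (real (card R) - 1) * (?s / (2 * ?s - 1)) \<le> (real n - 2) * (?s / (2 * ?s - 1))"
        by (simp only: distrib_right)
    qed
    then show False using rho_l l(1) by simp
  qed
qed

lemma complete_split_extremal:
  fixes G :: "'a pair_pre_digraph" and m :: nat
  defines "H \<equiv> graph_join (complete_graph m) (empty_graph m)"
  assumes "pair_graph G" and "connected (with_proj G)" and "card (pverts G) = 2 * m"
    and m: "m = 2 \<or> m = 3"
    and rho: "graph_spectral_radius G \<ge> graph_spectral_radius H"
    and niso: "\<not> digraph_iso (with_proj G) (with_proj H)"
    and v: "v \<in> pverts G"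
  shows "has_K2_cycle_factor (pre_digraph.del_vert (with_proj G) v)"
proof (rule ccontr)
  interpret G: pair_graph G by fact
  assume "\<not> ?thesis"
  then obtain T R I where part: "tripartition (pverts G) T R I" and "T \<noteq> {}"
    and TI: "card T = card I" and adj: "\<And>u w. (u, w) \<in> parcs G \<Longrightarrow> join_adj T I u w"
    using no_factor_imp_tripartition[OF assms(2) v] by metis
  have ne: "pverts G \<noteq> {}" using v by blast
  have fin: "finite (pverts G)" by simp
  have "finite T" "finite R" using part fin by (auto simp: tripartition_def)
  then have "card T > 0" using \<open>T \<noteq> {}\<close> by (simp add: card_gt_0_iff)
  have cn: "2 * m = 2 * card T + card R"
    using card_tripartition[OF fin part] assms(4) TI by simp
  \<comment> \<open>The positive root of \<open>l * l = (m - 1) * l + m * m\<close>, the quotient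
    equation of the extremal graph with weight \<open>m / l\<close> on \<open>I\<close>.\<close>
  define l where "l = (if m = 2 then (1 + sqrt 17) / 2 else 1 + sqrt 10)"
  \<comment> \<open>The rational thresholds \<open>5 / 2\<close> and \<open>41 / 10\<close> lie
    below \<open>l\<close> and still bound the spectral radius of \<open>G\<close> whenever
    \<open>card T < m\<close>.\<close>
  have "sqrt 17 > 4" "sqrt 10 > 31 / 10"
    by (rule real_less_rsqrt, simp add: power2_eq_square)+
  then have l: "if m = 2 then l > 5 / 2 else l > 41 / 10" by (simp add: l_def)
  then have l0: "l > 0" by (auto split: if_splits)
  have "l * l = (real m - 1) * l + real m * real m"
    using m by (auto simp: l_def field_simps)
  then have eqT: "real m - 1 + real m * (real m / l) = l"
    using l0 by (simp add: field_simps)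
  have eqI: "real m = l * (real m / l)" using l0 by simp
  note split = complete_split_tripartition(1,4)[where m = m, folded H_def] complete_split_tripartition(2,3)
  have H: "pair_graph H" unfolding H_def by (rule pair_graph_complete_split)
  \<comment> \<open>Since the part \<open>R\<close> is empty, the value \<open>b = 1\<close> is a
    mere placeholder.\<close>
  have "l \<le> graph_spectral_radius H"
    by (rule join_le_spectral_radius[OF H split(1) _ split(2), where b = 1 and c = "real m / l"])
      (use split(3,4) eqT eqI m in \<open>auto simp: lessThan_empty_iff\<close>)
  then have rho_l: "graph_spectral_radius G \<ge> l" using rho by simp
  note bound = spectral_radius_le_join[OF assms(2) ne part adj]
  show False
  proof (cases "card T = m")
    case True
    then have R: "R = {}" using cn \<open>finite R\<close> by simp
    have pos: "(1::real) > 0" "real m / l > 0" using m l0 by auto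
    have "join_adj T I u w \<Longrightarrow> (u, w) \<in> parcs G" if "u \<in> pverts G" "w \<in> pverts G" for u w
      by (rule spectral_radius_eq_imp_join[OF assms(2) ne part adj pos _ _ _ rho_l assms(3) that])
        (use True TI R eqT eqI in auto)
    then have "(u, w) \<in> parcs G \<longleftrightarrow> join_adj T I u w" if "u \<in> pverts G" "w \<in> pverts G" for u w
      using adj that by blast
    then have "digraph_iso (with_proj G) (with_proj H)"
      using True TI R split by (intro join_digraph_iso[OF assms(2) H part split(1)]) auto
    then show False using niso by blast
  next
    case False
    then have "m = 2 \<and> card T = 1 \<and> card R = 2 \<or> m = 3 \<and> card T = 1 \<and> card R = 4
        \<or> m = 3 \<and> card T = 2 \<and> card R = 2"
      using m cn \<open>card T > 0\<close> by presburger
    then consider "m = 2" "card T = 1" "card R = 2" | "m = 3" "card T = 1" "card R = 4"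
      | "m = 3" "card T = 2" "card R = 2"
      by blast
    then show False
      \<comment> \<open>For a bound \<open>l\<close> the weights are \<open>b = s / (l - r + 1)\<close> and \<open>c = s / l\<close>, where \<open>s\<close> and
        \<open>r\<close> are the cardinalities of \<open>T\<close> and \<open>R\<close>.\<close>
    proof cases
      case 1
      have "graph_spectral_radius G \<le> 5 / 2"
        by (rule bound[of "2 / 3" "2 / 5"]) (use 1 TI in auto)
      then show False using rho_l l 1 by simp
    next
      case 2
      have "graph_spectral_radius G \<le> 41 / 10"
        by (rule bound[of "10 / 11" "10 / 41"]) (use 2 TI in auto)
      then show False using rho_l l 2 by simp
    next
      case 3
      have "graph_spectral_radius G \<le> 41 / 10"
        by (rule bound[of "20 / 31" "20 / 41"]) (use 3 TI in auto)
      then show False using rho_l l 3 by simp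
    qed
  qed
qed

theorem corollary6p5:
  fixes G :: "'a pair_pre_digraph" and n :: nat
  assumes "n \<ge> 3"
    and "pair_graph G"
    and "connected (with_proj G)"
    and "card (pverts G) = n"
  shows
    "((n \<ge> 7 \<or> n = 3 \<or> n = 5) \<and>
      graph_spectral_radius G \<ge> graph_spectral_radius
        (graph_join (complete_graph 1) (graph_union (complete_graph (n - 2)) (complete_graph 1))) \<and>
      \<not> digraph_iso (with_proj G) (with_proj
        (graph_join (complete_graph 1) (graph_union (complete_graph (n - 2)) (complete_graph 1))))
      \<longrightarrow> (\<forall>v\<in>pverts G. has_K2_cycle_factor (pre_digraph.del_vert (with_proj G) v)))
    \<and>
     (n \<in> {4, 6} \<and>
      graph_spectral_radius G \<ge> graph_spectral_radius
        (graph_join (complete_graph (n div 2)) (empty_graph (n div 2))) \<and>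
      \<not> digraph_iso (with_proj G) (with_proj
        (graph_join (complete_graph (n div 2)) (empty_graph (n div 2))))
      \<longrightarrow> (\<forall>v\<in>pverts G. has_K2_cycle_factor (pre_digraph.del_vert (with_proj G) v)))"
proof (intro conjI impI ballI; elim conjE)
  fix v assume "v \<in> pverts G" and "n \<in> {4, 6}"
    and "graph_spectral_radius G \<ge> graph_spectral_radius
        (graph_join (complete_graph (n div 2)) (empty_graph (n div 2)))"
    and "\<not> digraph_iso (with_proj G) (with_proj
        (graph_join (complete_graph (n div 2)) (empty_graph (n div 2))))"
  then show "has_K2_cycle_factor (pre_digraph.del_vert (with_proj G) v)"
    using assms(4) by (intro complete_split_extremal[OF assms(2,3), of "n div 2"]) auto
qed (rule kite_extremal[OF assms(2-4)])

end
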